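(* Let $k$ be a field and let $A$ be a finite dimensional associative unital $k$-algebra. Then $A$ is self-dual if and only if it is a symmetric Frobenius algebra. In particular, commutative Frobenius algebras are self-dual.
   Context: An associative $k$-algebra $A$ is self-dual if it admits a dualizing form, i.e. a $k$-bilinear form $\langle-,-\rangle:A\times A\to k$ for which the associated $k$-linear map $A\to A^{\vee}=\operatorname{Hom}_k(A,k)$, $a\mapsto\langle a,-\rangle$, is an isomorphism and which satisfies $\langle ac,b\rangle=\langle a,cb\rangle$ and $\langle ca,b\rangle=\langle a,bc\rangle$ for all $a,b,c\in A$. Equivalently, there is an $A$-bimodule isomorphism $A\to A^{\vee\,\mathrm{op}}$, where $A^{\vee\,\mathrm{op}}$ is $A^\vee$ with the $A$-bimodule structure $(afb)(x)=f(bxa)$. A Frobenius algebra is a finite dimensional associative algebra $A$ over a field $k$ together with a linear functional $f:A\to k$ satisfying any of the following equivalent conditions: (i) the kernel of $f$ contains no nonzero left ideal; (ii) the kernel of $f$ contains no nonzero right ideal; (iii) the bilinear Frobenius form $\langle a,b\rangle=f(ab)$ is non-degenerate. It is a symmetric Frobenius algebra if the Frobenius form is symmetric. The statement "A is a symmetric Frobenius algebra" means that such an $f$ with symmetric Frobenius form exists. *)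

theory Defs
  imports Complex_Main
begin

locale assoc_algebra = vector_space scale
  for scale :: "'k::field \<Rightarrow> 'a::ring \<Rightarrow> 'a" (infixr "*s" 75) +
  assumes mult_scale_left: "(r *s x) * y = r *s (x * y)"
    and mult_scale_right: "x * (r *s y) = r *s (x * y)"
begin

definition dual_space :: "('a \<Rightarrow> 'k) set" where
  "dual_space = {f. Vector_Spaces.linear scale (*) f}"

definition bilinear_form :: "('a \<Rightarrow> 'a \<Rightarrow> 'k) \<Rightarrow> bool" where
  "bilinear_form \<phi> \<longleftrightarrow>
     (\<forall>a. Vector_Spaces.linear scale (*) (\<lambda>b. \<phi> a b)) \<and>
     (\<forall>b. Vector_Spaces.linear scale (*) (\<lambda>a. \<phi> a b))"

text \<open>
  For a bilinear form the curried map from the algebra to its dual is linear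
  (with pointwise operations on the dual), so it is an isomorphism of vector spaces
  exactly if it is a bijection onto the dual.
\<close>

definition dualizing_form :: "('a \<Rightarrow> 'a \<Rightarrow> 'k) \<Rightarrow> bool" where
  "dualizing_form \<phi> \<longleftrightarrow>
     bilinear_form \<phi> \<and>
     bij_betw (\<lambda>a. (\<lambda>b. \<phi> a b)) UNIV dual_space \<and>
     (\<forall>a b c. \<phi> (a * c) b = \<phi> a (c * b)) \<and>
     (\<forall>a b c. \<phi> (c * a) b = \<phi> a (b * c))"

definition self_dual :: bool where
  "self_dual \<longleftrightarrow> (\<exists>\<phi>. dualizing_form \<phi>)"

definition nondegenerate :: "('a \<Rightarrow> 'a \<Rightarrow> 'k) \<Rightarrow> bool" where
  "nondegenerate \<phi> \<longleftrightarrow>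
     (\<forall>a. (\<forall>b. \<phi> a b = 0) \<longrightarrow> a = 0) \<and>
     (\<forall>b. (\<forall>a. \<phi> a b = 0) \<longrightarrow> b = 0)"

end

text \<open>
  The sort \<open>{ring, monoid_mult}\<close> describes unital rings without the requirement
  \<open>0 \<noteq> 1\<close> of \<open>ring_1\<close>, so the zero algebra is included.
\<close>

locale fin_dim_unital_algebra = assoc_algebra scale
  for scale :: "'k::field \<Rightarrow> 'a::{ring, monoid_mult} \<Rightarrow> 'a" (infixr "*s" 75) +
  assumes finite_dimensional: "\<exists>Basis. finite_dimensional_vector_space scale Basis"
begin

definition frobenius_functional :: "('a \<Rightarrow> 'k) \<Rightarrow> bool" where
  "frobenius_functional f \<longleftrightarrow>
     f \<in> dual_space \<and> nondegenerate (\<lambda>a b. f (a * b))"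

definition frobenius_algebra :: bool where
  "frobenius_algebra \<longleftrightarrow> (\<exists>f. frobenius_functional f)"

definition symmetric_frobenius_algebra :: bool where
  "symmetric_frobenius_algebra \<longleftrightarrow>
     (\<exists>f. frobenius_functional f \<and> (\<forall>a b. f (a * b) = f (b * a)))"

end

end

theory Submission
  imports Defs
begin

text \<open>
  A dualizing form is determined by the functional \<open>f = \<phi> 1\<close>: the first invariance gives
  \<open>\<phi> a b = f (a * b)\<close>, and the second one makes \<open>f\<close> symmetric. Conversely, for a symmetric
  Frobenius functional \<open>f\<close> the form \<open>f (a * b)\<close> is invariant by associativity and symmetry,
  and nondegeneracy makes \<open>a \<mapsto> f (a * _)\<close> injective, hence bijective since the algebra and
  its dual have the same finite dimension.
\<close>

context assoc_algebra
begin

lemma dual_space_mult_left: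
  assumes "f \<in> dual_space"
  shows "(\<lambda>b. f (a * b)) \<in> dual_space"
proof -
  interpret f: Vector_Spaces.linear scale "(*)" f
    using assms by (simp add: dual_space_def)
  show ?thesis
    unfolding dual_space_def mem_Collect_eq
    by unfold_locales (simp_all add: distrib_left mult_scale_right f.add f.scale)
qed

lemma dual_space_mult_right:
  assumes "f \<in> dual_space"
  shows "(\<lambda>a. f (a * b)) \<in> dual_space"
proof -
  interpret f: Vector_Spaces.linear scale "(*)" f
    using assms by (simp add: dual_space_def)
  show ?thesis
    unfolding dual_space_def mem_Collect_eq
    by unfold_locales (simp_all add: distrib_right mult_scale_left f.add f.scale)
qed

lemma bilinear_form_mult:
  "f \<in> dual_space \<Longrightarrow> bilinear_form (\<lambda>a b. f (a * b))"
  using dual_space_mult_left dual_space_mult_right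
  by (auto simp: bilinear_form_def dual_space_def)

lemma bilinear_form_in_dual_space: "bilinear_form \<phi> \<Longrightarrow> \<phi> a \<in> dual_space"
  by (simp add: bilinear_form_def dual_space_def)

lemma bilinear_form_zero_left:
  assumes "bilinear_form \<phi>"
  shows "\<phi> 0 b = 0"
  using assms module_hom.zero[OF Vector_Spaces.linear.axioms(3)]
  by (fastforce simp: bilinear_form_def)

lemma dual_space_eqI:
  assumes "f \<in> dual_space" "g \<in> dual_space" "span B = UNIV" "\<And>b. b \<in> B \<Longrightarrow> f b = g b"
  shows "f = g"
proof -
  interpret f: Vector_Spaces.linear scale "(*)" f
    using assms(1) by (simp add: dual_space_def)
  interpret g: Vector_Spaces.linear scale "(*)" g
    using assms(2) by (simp add: dual_space_def)
  have "f x = g x" for x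
  proof -
    have "x \<in> span B" using assms(3) by simp
    then show ?thesis
      by (induction rule: span_induct_alt)
        (simp_all add: assms(4) f.zero g.zero f.add g.add f.scale g.scale)
  qed
  then show ?thesis by blast
qed

text \<open>A linear injection between spaces of equal finite dimension is bijective. Since
  \<open>dual_space\<close> is a set of functions rather than a type with its own vector space
  structure, the argument is carried over to an endomorphism of the algebra itself.\<close>

lemma bij_betw_dual_space:
  assumes "finite_dimensional_vector_space scale B"
    and bilin: "bilinear_form \<phi>"
    and nondeg: "\<And>a. (\<forall>b. \<phi> a b = 0) \<Longrightarrow> a = 0"
  shows "bij_betw \<phi> UNIV dual_space"
proof -
  interpret B: finite_dimensional_vector_space scale B by fact
  note dual = bilinear_form_in_dual_space[OF bilin]
  have linear_left: "Vector_Spaces.linear scale (*) (\<lambda>a. \<phi> a b)" for b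
    using bilin by (simp add: bilinear_form_def)
  note add = Vector_Spaces.linear.axioms(3)[OF linear_left, THEN module_hom.add]
  note scale = Vector_Spaces.linear.axioms(3)[OF linear_left, THEN module_hom.scale]
  \<comment> \<open>The coordinates of \<open>T a\<close> in the basis are the values of
    \<open>\<phi> a\<close> on it: \<open>T\<close> is \<open>\<phi>\<close> followed by the
    identification of the dual with the algebra that sends the dual basis to
    \<open>B\<close>.\<close>
  define T where "T a = (\<Sum>b\<in>B. \<phi> a b *s b)" for a
  have coeffs: "h b = 0" if "(\<Sum>b\<in>B. h b *s b) = 0" "b \<in> B" for h b
    using B.independent_Basis B.finite_Basis that independentD[of B B h b] by blast
  have phi_eq_0: "a = 0" if "\<And>b. b \<in> B \<Longrightarrow> \<phi> a b = 0" for a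
  proof -
    \<comment> \<open>Both are functionals in the dual and both vanish on the basis, so they agree
      everywhere; this turns vanishing on \<open>B\<close> into the hypothesis of
      \<open>nondeg\<close>.\<close>
    have "\<phi> a = \<phi> 0"
      using dual_space_eqI[OF dual dual B.span_Basis, of a 0] that
      by (auto simp: bilinear_form_zero_left[OF bilin])
    then show ?thesis by (intro nondeg) (simp add: bilinear_form_zero_left[OF bilin])
  qed
  have linear_T: "Vector_Spaces.linear scale scale T"
    by unfold_locales
      (simp_all add: T_def add scale scale_left_distrib sum.distrib scale_sum_right)
  have "inj T"
  proof (subst module_hom.inj_iff_eq_0[OF Vector_Spaces.linear.axioms(3)[OF linear_T]], intro allI impI)
    fix a assume "T a = 0"
    then show "a = 0" using coeffs phi_eq_0 unfolding T_def by blast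
  qed
  then have "surj T" using B.linear_inj_imp_surj[OF linear_T] by blast
  have "inj \<phi>"
  proof (rule injI)
    fix a b assume "\<phi> a = \<phi> b"
    then have "T a = T b" by (simp add: T_def)
    then show "a = b" using \<open>inj T\<close> by (simp add: inj_eq)
  qed
  moreover have "g \<in> range \<phi>" if g: "g \<in> dual_space" for g
  proof -
    \<comment> \<open>The candidate preimage of \<open>g\<close> is the element that
      \<open>T\<close> sends to the vector whose coordinates are the values of \<open>g\<close> on
      \<open>B\<close>. Independence then compares coefficients, and a functional is determined by
      its values on a basis.\<close>
    obtain a where "T a = (\<Sum>b\<in>B. g b *s b)" using \<open>surj T\<close> by (metis surjD)
    then have "(\<Sum>b\<in>B. (\<phi> a b - g b) *s b) = 0"
      by (simp add: T_def scale_left_diff_distrib sum_subtractf)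
    then have "\<phi> a b = g b" if "b \<in> B" for b
      using coeffs that by fastforce
    then have "\<phi> a = g" using dual g B.span_Basis by (intro dual_space_eqI[of _ _ B])
    then show ?thesis by blast
  qed
  ultimately show ?thesis using dual by (auto simp: bij_betw_def)
qed

end

context fin_dim_unital_algebra
begin

lemma self_dual_imp_symmetric_frobenius:
  assumes self_dual
  shows symmetric_frobenius_algebra
proof -
  obtain \<phi> where bilin: "bilinear_form \<phi>" and inj: "inj \<phi>"
    and invariant: "\<And>a b c. \<phi> (a * c) b = \<phi> a (c * b)" "\<And>a b c. \<phi> (c * a) b = \<phi> a (b * c)"
    using assms by (auto simp: self_dual_def dualizing_form_def bij_betw_def)
  have phi_eq: "\<phi> 1 (a * b) = \<phi> a b" for a b
    using invariant(1)[of 1 a b] by simp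
  \<comment> \<open>With the unit in the first slot, the second invariance becomes
    \<open>\<phi> a b = \<phi> 1 (b * a)\<close>, and the right side is \<open>\<phi> b a\<close> by
    \<open>phi_eq\<close>.\<close>
  have sym: "\<phi> a b = \<phi> b a" for a b
    using invariant(2)[of a 1 b] by (simp add: phi_eq)
  \<comment> \<open>Injectivity yields nondegeneracy in the left argument; symmetry then transfers
    it to the right one.\<close>
  have "a = 0" if "\<forall>b. \<phi> a b = 0" for a
    using that bilinear_form_zero_left[OF bilin] by (intro injD[OF inj] ext) simp
  then have "frobenius_functional (\<phi> 1)"
    using bilinear_form_in_dual_space[OF bilin] sym
    by (auto simp: frobenius_functional_def nondegenerate_def phi_eq)
  then show ?thesis
    unfolding symmetric_frobenius_algebra_def using phi_eq sym by metis
qed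

lemma symmetric_frobenius_imp_self_dual:
  assumes symmetric_frobenius_algebra
  shows self_dual
proof -
  obtain f where f: "f \<in> dual_space" and nondeg: "nondegenerate (\<lambda>a b. f (a * b))"
    and sym: "\<And>a b. f (a * b) = f (b * a)"
    using assms by (auto simp: symmetric_frobenius_algebra_def frobenius_functional_def)
  obtain B where "finite_dimensional_vector_space scale B"
    using finite_dimensional by blast
  then have "bij_betw (\<lambda>a b. f (a * b)) UNIV dual_space"
    using bij_betw_dual_space[OF _ bilinear_form_mult[OF f]] nondeg
    unfolding nondegenerate_def by blast
  \<comment> \<open>Symmetry of the form makes \<open>f\<close> invariant under cyclic rotation of a
    product, which is the second invariance; the first is associativity.\<close>
  moreover have "f (c * a * b) = f (a * (b * c))" for a b c
    using sym[of c "a * b"] by (simp add: mult.assoc)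
  ultimately have "dualizing_form (\<lambda>a b. f (a * b))"
    using bilinear_form_mult[OF f] by (simp add: dualizing_form_def mult.assoc)
  then show ?thesis by (auto simp: self_dual_def)
qed

end

theorem theorem2:
  fixes scale :: "'k::field \<Rightarrow> 'a::{ring, monoid_mult} \<Rightarrow> 'a"
  assumes "fin_dim_unital_algebra scale"
  shows "(assoc_algebra.self_dual scale \<longleftrightarrow>
            fin_dim_unital_algebra.symmetric_frobenius_algebra scale) \<and>
         ((\<forall>a b :: 'a. a * b = b * a) \<and> fin_dim_unital_algebra.frobenius_algebra scale
            \<longrightarrow> assoc_algebra.self_dual scale)"
proof -
  interpret fin_dim_unital_algebra scale by fact
  \<comment> \<open>Over a commutative algebra every Frobenius functional has a symmetric form, so
    the second claim reduces to the equivalence.\<close>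
  have "symmetric_frobenius_algebra" if "\<forall>a b :: 'a. a * b = b * a" "frobenius_algebra"
    using that unfolding frobenius_algebra_def symmetric_frobenius_algebra_def by metis
  then show ?thesis
    using self_dual_imp_symmetric_frobenius symmetric_frobenius_imp_self_dual by blast
qed

end
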